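(* Let $n\ge 3$. For the ferromagnetic Ising model on the cycle with $n$ vertices and couplings $\mathbf J=(J_1,\dots,J_n)$, $J_i>0$, the relaxation time $\tau_2=\tau_2(\mathbf J)$ of the heat-bath Glauber dynamics is an increasing function of each of the couplings $J_i$; that is, if $J_i\le J_i'$ for all $i$, then $\tau_2(\mathbf J)\le\tau_2(\mathbf J')$.
   Context: The cycle has vertices $\{1,\dots,n\}$ and edges $[1,2],[2,3],\dots,[n,1]$; indices are taken mod $n$, so $n+1\equiv 1$. The edge $[i,i+1]$ has coupling $J_i>0$. A configuration is $\sigma\in\{+1,-1\}^n$, and the Gibbs measure (no external field, no boundary conditions) is $\pi(\sigma)=Z^{-1}\exp\big(\sum_{i=1}^n J_i\sigma_i\sigma_{i+1}\big)$, where $Z$ is the normalizing constant. For a vertex $i$, let $\sigma^i$ be the configuration obtained from $\sigma$ by flipping the spin at $i$. The heat-bath Glauber dynamics is the Markov chain on $\{+1,-1\}^n$ with transition matrix $A$ of size $2^n\times 2^n$ given by $A(\sigma,\sigma^i)=\frac1n\,\frac{\pi(\sigma^i)}{\pi(\sigma)+\pi(\sigma^i)}$ for each $i$, $A(\sigma,\sigma)=1-\sum_{i}A(\sigma,\sigma^i)$, and $A(\sigma,\tau)=0$ for all other $\tau$. It is reversible with respect to $\pi$, so its eigenvalues are real; they are listed with multiplicity as $1=\mu_1>\mu_2\ge\dots\ge\mu_{2^n}$. The relaxation time is $\tau_2=\big(n(1-\mu_2)\big)^{-1}$. *)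

theory Defs
  imports Complex_Main "HOL-Library.FuncSet" "Jordan_Normal_Form.Char_Poly"
begin

text \<open>
  The vertices of the cycle are \<open>0, \<dots>, n - 1\<close> instead of \<open>1, \<dots>, n\<close>, so that
  \<open>J i\<close> is the coupling of the edge joining \<open>i\<close> and \<open>(i + 1) mod n\<close>; only the values
  \<open>J i\<close> with \<open>i < n\<close> are used.
\<close>

type_synonym config = "nat \<Rightarrow> real"

definition configs :: "nat \<Rightarrow> config set" where
  "configs n = ({..<n} \<rightarrow>\<^sub>E {1, -1})"

definition weight :: "nat \<Rightarrow> (nat \<Rightarrow> real) \<Rightarrow> config \<Rightarrow> real" where
  "weight n J \<sigma> = exp (\<Sum>i<n. J i * \<sigma> i * \<sigma> ((i + 1) mod n))"

definition gibbs :: "nat \<Rightarrow> (nat \<Rightarrow> real) \<Rightarrow> config \<Rightarrow> real" where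
  "gibbs n J \<sigma> = weight n J \<sigma> / (\<Sum>\<tau>\<in>configs n. weight n J \<tau>)"

definition flip :: "nat \<Rightarrow> config \<Rightarrow> config" where
  "flip i \<sigma> = \<sigma>(i := - \<sigma> i)"

definition update_prob :: "nat \<Rightarrow> (nat \<Rightarrow> real) \<Rightarrow> config \<Rightarrow> config \<Rightarrow> real" where
  "update_prob n J \<sigma> \<tau> = 1 / real n * (gibbs n J \<tau> / (gibbs n J \<sigma> + gibbs n J \<tau>))"

definition glauber :: "nat \<Rightarrow> (nat \<Rightarrow> real) \<Rightarrow> config \<Rightarrow> config \<Rightarrow> real" where
  "glauber n J \<sigma> \<tau> =
     (if \<tau> = \<sigma> then 1 - (\<Sum>i<n. update_prob n J \<sigma> (flip i \<sigma>))
      else if \<exists>i<n. \<tau> = flip i \<sigma> then update_prob n J \<sigma> \<tau>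
      else 0)"

text \<open>
  Rows and columns of library matrices are numbered by naturals, so the configurations are
  numbered \<open>0, \<dots>, 2 ^ n - 1\<close>, the binary digits giving the spins.  The characteristic
  polynomial, hence the spectrum, does not depend on the numbering chosen.
\<close>

definition config_of :: "nat \<Rightarrow> nat \<Rightarrow> config" where
  "config_of n k = (\<lambda>i\<in>{..<n}. if bit k i then 1 else - 1)"

lemma bij_betw_config_of: "bij_betw (config_of n) {..<2 ^ n} (configs n)"
proof -
  have inj: "inj_on (config_of n) {..<2 ^ n}"
  proof (rule inj_onI)
    fix k l :: nat
    assume k: "k \<in> {..<2 ^ n}" and l: "l \<in> {..<2 ^ n}" and eq: "config_of n k = config_of n l"
    have "bit k i = bit l i" if "i < n" for i
      using fun_cong[OF eq, of i] that by (simp add: config_of_def split: if_splits)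
    then have "take_bit n k = take_bit n l"
      by (auto simp: bit_eq_iff bit_take_bit_iff)
    then show "k = l"
      using k l by (simp add: take_bit_nat_eq_self)
  qed
  have sub: "config_of n ` {..<2 ^ n} \<subseteq> configs n"
    by (auto simp: config_of_def configs_def split: if_splits)
  have "card (configs n) = 2 ^ n"
    by (simp add: configs_def card_PiE numeral_2_eq_2)
  moreover have "card (config_of n ` {..<2 ^ n}) = 2 ^ n"
    using inj by (simp add: card_image)
  moreover have "finite (configs n)"
    by (simp add: configs_def finite_PiE)
  ultimately have "config_of n ` {..<2 ^ n} = configs n"
    using sub by (intro card_subset_eq) auto
  with inj show ?thesis
    by (simp add: bij_betw_def)
qed

definition glauber_mat :: "nat \<Rightarrow> (nat \<Rightarrow> real) \<Rightarrow> real mat" where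
  "glauber_mat n J =
     mat (2 ^ n) (2 ^ n) (\<lambda>(k, l). glauber n J (config_of n k) (config_of n l))"

text \<open>
  The eigenvalues in decreasing order, with multiplicity; \<open>mu\<close> numbers them from 1.  As the
  matrix is reversible, all complex eigenvalues are real and are among the real roots, and
  algebraic and geometric multiplicities agree.
\<close>

definition glauber_eigenvalues :: "nat \<Rightarrow> (nat \<Rightarrow> real) \<Rightarrow> real list" where
  "glauber_eigenvalues n J = rev (sorted_list_of_multiset (proots (char_poly (glauber_mat n J))))"

definition mu :: "nat \<Rightarrow> (nat \<Rightarrow> real) \<Rightarrow> nat \<Rightarrow> real" where
  "mu n J k = glauber_eigenvalues n J ! (k - 1)"

definition relaxation_time :: "nat \<Rightarrow> (nat \<Rightarrow> real) \<Rightarrow> real" where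
  "relaxation_time n J = inverse (real n * (1 - mu n J 2))"

end

theory Submission
  imports Defs "HOL-Analysis.Function_Topology"
begin

text \<open>
  A vertex of the cycle has only two neighbours, so its mean spin given the rest is a linear
  function of the neighbouring spins, with coefficients \<open>sinh (2 * J)\<close> over a sum of two
  \<open>cosh (2 * J)\<close>.  Hence linear observables are preserved by the dynamics, and finding an
  eigenfunction among them amounts to the generalized symmetric eigenvalue problem
  \<open>S h = l D h\<close>, where \<open>S\<close> is the adjacency form with edge weights \<open>sinh (2 * J i)\<close> and \<open>D\<close> is
  diagonal.  Its top solution \<open>h\<close> is positive, so the eigenfunction
  \<open>f = (\<Sum>k. D k * h k * \<sigma> k)\<close> is strictly increasing.  Since the dynamics preserves increasing
  functions, any non-constant eigenfunction \<open>g\<close> has eigenvalue at most that of \<open>f\<close>: compare the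
  least \<open>d\<close> for which \<open>d f + g\<close> and \<open>d f - g\<close> are both increasing before and after one step.
  So the relaxation time is \<open>1 / (1 - l)\<close>.

  To compare \<open>l\<close> and \<open>l'\<close>, pair each eigenvector with the equation of the other.  The sign of
  \<open>l' - l\<close> is then decided edge by edge, by \<open>h (i + 1) / h i\<close> lying between \<open>tanh (J i)\<close>
  and its inverse.  That bound is itself a minimum principle: the quantities
  \<open>a i = cosh (J i) * (cosh (J i) * h (i + 1) - sinh (J i) * h i)\<close> satisfy
  \<open>a (i - 1) - tanh (J i) * a i = (1 - l) * D i * h i / 2 > 0\<close>.
\<close>

subsection \<open>The generalized eigenvalue problem on the cycle\<close>

definition succ_mod :: "nat \<Rightarrow> nat \<Rightarrow> nat" where
  "succ_mod n i = (i + 1) mod n"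

definition pred_mod :: "nat \<Rightarrow> nat \<Rightarrow> nat" where
  "pred_mod n i = (if i = 0 then n - 1 else i - 1)"

lemma succ_mod_eq: "i < n \<Longrightarrow> succ_mod n i = (if Suc i = n then 0 else Suc i)"
  by (auto simp: succ_mod_def)

lemma succ_mod_less: "i < n \<Longrightarrow> succ_mod n i < n"
  by (auto simp: succ_mod_eq)

lemma pred_mod_less: "i < n \<Longrightarrow> pred_mod n i < n"
  by (auto simp: pred_mod_def)

lemma pred_succ_mod [simp]: "i < n \<Longrightarrow> pred_mod n (succ_mod n i) = i"
  by (auto simp: pred_mod_def succ_mod_eq)

lemma succ_pred_mod [simp]: "i < n \<Longrightarrow> succ_mod n (pred_mod n i) = i"
  by (auto simp: pred_mod_def succ_mod_eq)

lemma succ_mod_neq: "2 \<le> n \<Longrightarrow> i < n \<Longrightarrow> succ_mod n i \<noteq> i"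
  by (auto simp: succ_mod_eq)

lemma pred_mod_neq: "2 \<le> n \<Longrightarrow> i < n \<Longrightarrow> pred_mod n i \<noteq> i"
  by (auto simp: pred_mod_def)

text \<open>A sum over edges may be indexed by either endpoint; \<open>F\<close> receives the two
  endpoints in cyclic order.\<close>

lemma sum_shift_mod:
  fixes F :: "nat \<Rightarrow> nat \<Rightarrow> 'a :: comm_monoid_add"
  shows "(\<Sum>i<n. F (pred_mod n i) i) = (\<Sum>i<n. F i (succ_mod n i))"
  by (rule sum.reindex_bij_witness[where i = "succ_mod n" and j = "pred_mod n"])
    (auto simp: succ_mod_less pred_mod_less)

text \<open>Climb from \<open>i\<close> to \<open>n - 1\<close>, wrap around to 0, then climb to
  \<open>j\<close>.\<close>

lemma cyclic_induct:
  assumes "i < n" "P i" "\<And>i. i < n \<Longrightarrow> P i \<Longrightarrow> P (succ_mod n i)" "j < n"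
  shows "P j"
proof -
  have step: "P (Suc k)" if "P k" "Suc k < n" for k
    using assms(3)[of k] that by (simp add: succ_mod_eq)
  have up: "P (k + d)" if "P k" "k + d < n" for k d
    using that(2)
  proof (induction d)
    case (Suc d)
    then show ?case using step[of "k + d"] by simp
  qed (use that in simp)
  have "P (n - 1)"
    using up[of i "n - 1 - i"] assms(1,2) by simp
  then have "P 0"
    using assms(3)[of "n - 1"] assms(1) by (simp add: succ_mod_eq)
  then show ?thesis
    using up[of 0 j] assms(4) by simp
qed

section \<open>Edge and vertex forms\<close>

definition edge_form :: "nat \<Rightarrow> (nat \<Rightarrow> real) \<Rightarrow> (nat \<Rightarrow> real) \<Rightarrow> (nat \<Rightarrow> real) \<Rightarrow> real" where
  "edge_form n J g h =
     (\<Sum>i<n. sinh (2 * J i) * (g i * h (succ_mod n i) + g (succ_mod n i) * h i))"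

text \<open>The diagonal form with entries \<open>vertex_weight\<close>, spread over the edges so
  that it can be compared with \<open>edge_form\<close> edge by edge.\<close>

definition vertex_form :: "nat \<Rightarrow> (nat \<Rightarrow> real) \<Rightarrow> (nat \<Rightarrow> real) \<Rightarrow> (nat \<Rightarrow> real) \<Rightarrow> real" where
  "vertex_form n J g h =
     (\<Sum>i<n. cosh (2 * J i) * (g i * h i + g (succ_mod n i) * h (succ_mod n i)))"

definition vertex_weight :: "nat \<Rightarrow> (nat \<Rightarrow> real) \<Rightarrow> nat \<Rightarrow> real" where
  "vertex_weight n J i = cosh (2 * J (pred_mod n i)) + cosh (2 * J i)"

text \<open>Row \<open>i\<close> of the adjacency form applied to \<open>h\<close>. For a
  configuration it is \<open>vertex_weight\<close> times the conditional mean spin at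
  \<open>i\<close>.\<close>

definition neighbour_sum :: "nat \<Rightarrow> (nat \<Rightarrow> real) \<Rightarrow> (nat \<Rightarrow> real) \<Rightarrow> nat \<Rightarrow> real" where
  "neighbour_sum n J h i =
     sinh (2 * J (pred_mod n i)) * h (pred_mod n i) + sinh (2 * J i) * h (succ_mod n i)"

lemma vertex_weight_ge: "2 \<le> vertex_weight n J i"
  using cosh_real_ge_1[of "2 * J (pred_mod n i)"] cosh_real_ge_1[of "2 * J i"]
  by (simp add: vertex_weight_def)

lemma vertex_weight_pos: "0 < vertex_weight n J i"
  using vertex_weight_ge[of n J i] by linarith

lemma edge_form_eq_sum: "edge_form n J g h = (\<Sum>i<n. g i * neighbour_sum n J h i)"
proof -
  have "(\<Sum>i<n. sinh (2 * J i) * (g (succ_mod n i) * h i)) =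
        (\<Sum>i<n. sinh (2 * J (pred_mod n i)) * (g i * h (pred_mod n i)))"
    by (rule sum_shift_mod[where F = "\<lambda>j i. sinh (2 * J j) * (g i * h j)", symmetric])
  then show ?thesis
    by (simp add: edge_form_def neighbour_sum_def distrib_left sum.distrib algebra_simps)
qed

lemma vertex_form_eq_sum: "vertex_form n J g h = (\<Sum>i<n. g i * (vertex_weight n J i * h i))"
proof -
  have "(\<Sum>i<n. cosh (2 * J i) * (g (succ_mod n i) * h (succ_mod n i))) =
        (\<Sum>i<n. cosh (2 * J (pred_mod n i)) * (g i * h i))"
    by (rule sum_shift_mod[where F = "\<lambda>j i. cosh (2 * J j) * (g i * h i)", symmetric])
  then show ?thesis
    by (simp add: vertex_form_def vertex_weight_def distrib_left sum.distrib algebra_simps)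
qed

lemma vertex_form_pos:
  assumes "i < n" "h i \<noteq> 0"
  shows "0 < vertex_form n J h h"
  unfolding vertex_form_eq_sum
proof (rule sum_pos2[where i = i])
  show "0 < h i * (vertex_weight n J i * h i)"
    using assms(2) vertex_weight_pos[of n J i]
    by (metis mult.commute mult.left_commute mult_pos_pos not_square_less_zero
        mult_eq_0_iff linorder_neqE_linordered_idom)
  show "0 \<le> h j * (vertex_weight n J j * h j)" for j
    using vertex_weight_pos[of n J j]
    by (metis less_imp_le mult.left_commute mult_nonneg_nonneg zero_le_square)
qed (use assms in auto)

section \<open>Existence of a positive eigenpair\<close>

lemma real_quadratic_nonneg_linear_zero:
  fixes b c :: real
  assumes "\<And>x. 0 \<le> 2 * x * b + x\<^sup>2 * c"
  shows "b = 0"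
proof (rule ccontr)
  assume b: "b \<noteq> 0"
  \<comment> \<open>A positive upper bound for \<open>c\<close>; minimizing with \<open>d\<close> in
    place of \<open>c\<close> also covers \<open>c <= 0\<close>.\<close>
  define d where "d = 1 + \<bar>c\<bar>"
  have d: "0 < d" "c \<le> d" by (auto simp: d_def)
  define x where "x = - b / d"
  have "2 * x * b + x\<^sup>2 * c \<le> 2 * x * b + x\<^sup>2 * d"
    using d by (intro add_left_mono mult_left_mono) auto
  also have "\<dots> = - b\<^sup>2 / d"
    unfolding x_def using d by (simp add: field_simps power2_eq_square)
  also have "\<dots> < 0"
    using b d by (intro divide_neg_pos) auto
  finally show False
    using assms[of x] by linarith
qed

text \<open>The Rayleigh quotient attains its maximum on the compact set where
  \<open>vertex_form\<close> is 1. Clearing denominators makes the bound cover also a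
  \<open>g\<close> vanishing on the cycle.\<close>

lemma rayleigh_maximizer:
  assumes n: "0 < n"
  obtains h where "0 < vertex_form n J h h"
    "\<And>g. edge_form n J g g * vertex_form n J h h \<le> edge_form n J h h * vertex_form n J g g"
proof -
  \<comment> \<open>Vectors are functions on all naturals, so the coordinates outside the cycle are
    pinned to 0; Tychonoff's theorem gives compactness.\<close>
  define K where "K = PiE UNIV (\<lambda>i. if i < n then {-1..1::real} else {0})"
  define U where "U = K \<inter> {h. vertex_form n J h h = 1}"
  have "compactin (product_topology (\<lambda>i::nat. euclidean) UNIV) K"
    unfolding K_def by (subst compactin_PiE) auto
  then have "compact K"
    by (simp add: euclidean_product_topology)
  have cont_v: "continuous_on UNIV (\<lambda>h. vertex_form n J h h)"
    unfolding vertex_form_def by (intro continuous_intros continuous_on_product_coordinates)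
  have cont_e: "continuous_on UNIV (\<lambda>h. edge_form n J h h)"
    unfolding edge_form_def by (intro continuous_intros continuous_on_product_coordinates)
  have "closed {h. vertex_form n J h h = 1}"
    using cont_v by (intro closed_Collect_eq) auto
  then have "compact U"
    unfolding U_def using \<open>compact K\<close> by (rule compact_Int_closed[rotated])
  have normalized: "\<exists>k\<in>U. edge_form n J k k = edge_form n J g g / vertex_form n J g g"
    if "0 < vertex_form n J g g" for g
  proof -
    define v where "v = vertex_form n J g g"
    define k where "k = (\<lambda>i. if i < n then g i / sqrt v else 0)"
    have v: "0 < v" using that by (simp add: v_def)
    have sq: "sqrt v * sqrt v = v" using v by simp
    have kv: "vertex_form n J k k = 1"
    proof -
      have "vertex_form n J k k = vertex_form n J g g / v"
        unfolding vertex_form_def sum_divide_distrib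
        by (intro sum.cong refl) (simp add: k_def succ_mod_less sq add_divide_distrib distrib_left del: real_sqrt_mult_self)
      then show ?thesis using v by (simp add: v_def)
    qed
    have ke: "edge_form n J k k = edge_form n J g g / v"
      unfolding edge_form_def sum_divide_distrib
      by (intro sum.cong refl) (simp add: k_def succ_mod_less sq add_divide_distrib distrib_left del: real_sqrt_mult_self)
    \<comment> \<open>Normalized vectors lie in the cube because every \<open>vertex_weight\<close>
      is at least 1.\<close>
    have "\<bar>k i\<bar> \<le> 1" if "i < n" for i
    proof -
      have "k i * (vertex_weight n J i * k i) \<le> (\<Sum>i<n. k i * (vertex_weight n J i * k i))"
      proof (rule member_le_sum)
        show "0 \<le> k x * (vertex_weight n J x * k x)" for x
          using vertex_weight_pos[of n J x]
          by (metis less_imp_le mult.left_commute mult_nonneg_nonneg zero_le_square)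
      qed (use that in auto)
      then have "(k i)\<^sup>2 * vertex_weight n J i \<le> 1"
        using kv by (simp add: vertex_form_eq_sum power2_eq_square algebra_simps)
      moreover have "(k i)\<^sup>2 * 1 \<le> (k i)\<^sup>2 * vertex_weight n J i"
        using vertex_weight_ge[of n J i] by (intro mult_left_mono) auto
      ultimately show ?thesis
        by (metis abs_square_le_1 mult_1_right order_trans)
    qed
    then have "k \<in> K"
      by (auto simp: K_def PiE_def Pi_def abs_le_iff minus_le_iff) (simp_all add: k_def)
    with kv ke show ?thesis
      by (auto simp: U_def v_def)
  qed
  have "0 < vertex_form n J (\<lambda>_. 1) (\<lambda>_. 1)"
    using n by (intro vertex_form_pos[of 0]) auto
  from normalized[OF this] have "U \<noteq> {}" by blast
  from continuous_attains_sup[OF \<open>compact U\<close> this continuous_on_subset[OF cont_e]]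
  obtain h where h: "h \<in> U" and max: "\<And>k. k \<in> U \<Longrightarrow> edge_form n J k k \<le> edge_form n J h h"
    by blast
  have vh: "vertex_form n J h h = 1" using h by (simp add: U_def)
  have "edge_form n J g g \<le> edge_form n J h h * vertex_form n J g g" for g
  proof (cases "\<exists>i<n. g i \<noteq> 0")
    case True
    then have pos: "0 < vertex_form n J g g"
      using vertex_form_pos by blast
    from normalized[OF this] max
    have "edge_form n J g g / vertex_form n J g g \<le> edge_form n J h h" by metis
    then show ?thesis using pos by (simp add: pos_divide_le_eq)
  next
    case False
    then show ?thesis by (simp add: edge_form_eq_sum vertex_form_eq_sum)
  qed
  with vh show ?thesis
    by (intro that[of h]) auto
qed

definition perron_pair :: "nat \<Rightarrow> (nat \<Rightarrow> real) \<Rightarrow> real \<Rightarrow> (nat \<Rightarrow> real) \<Rightarrow> bool" where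
  "perron_pair n J l h \<longleftrightarrow> 0 < l \<and> l < 1 \<and> (\<forall>i<n. 0 < h i) \<and>
     (\<forall>i<n. neighbour_sum n J h i = l * (vertex_weight n J i * h i))"

text \<open>Taking absolute values of a maximizer keeps \<open>vertex_form\<close> and cannot
  decrease \<open>edge_form\<close>, as all \<open>sinh\<close> weights are positive. The result is
  again a maximizer, and stationarity there is the eigenvector equation.\<close>

lemma perron_pair_exists:
  assumes n: "0 < n" and J: "\<And>i. i < n \<Longrightarrow> 0 < J i"
  obtains l h where "perron_pair n J l h"
proof -
  obtain h0 where h0: "0 < vertex_form n J h0 h0"
    "\<And>g. edge_form n J g g * vertex_form n J h0 h0 \<le> edge_form n J h0 h0 * vertex_form n J g g"
    using rayleigh_maximizer[OF n] by blast
  define l where "l = edge_form n J h0 h0 / vertex_form n J h0 h0"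
  define h where "h = (\<lambda>i. \<bar>h0 i\<bar>)"
  have bound: "edge_form n J g g \<le> l * vertex_form n J g g" for g
    using h0 by (simp add: l_def field_simps)
  have vh: "vertex_form n J h h = vertex_form n J h0 h0"
    by (simp add: vertex_form_def h_def)
  have sinh_pos: "0 < sinh (2 * J i)" if "i < n" for i
    using J[OF that] by simp
  have "edge_form n J h0 h0 \<le> edge_form n J h h"
    unfolding edge_form_def
  proof (intro sum_mono mult_left_mono)
    fix i assume "i \<in> {..<n}"
    then show "0 \<le> sinh (2 * J i)" using sinh_pos[of i] by simp
    show "h0 i * h0 (succ_mod n i) + h0 (succ_mod n i) * h0 i
      \<le> h i * h (succ_mod n i) + h (succ_mod n i) * h i"
      unfolding h_def by (intro add_mono) (simp_all flip: abs_mult)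
  qed
  then have eh: "edge_form n J h h = l * vertex_form n J h h"
    using bound[of h] h0(1) by (simp add: vh l_def)
  \<comment> \<open>The residual of the eigenvector equation. Moving \<open>h\<close> in direction
    \<open>g\<close> changes the nonnegative quantity \<open>l * vertex_form - edge_form\<close>,
    which is 0 at \<open>h\<close>, to first order by twice the squared norm of \<open>g\<close>; so
    \<open>g\<close> vanishes on the cycle.\<close>
  define g where "g = (\<lambda>i. l * (vertex_weight n J i * h i) - neighbour_sum n J h i)"
  have gsum: "(\<Sum>i<n. g i * g i) = l * vertex_form n J g h - edge_form n J g h"
    unfolding edge_form_eq_sum vertex_form_eq_sum sum_distrib_left sum_subtractf[symmetric]
    by (intro sum.cong refl) (simp add: g_def algebra_simps)
  have "(\<Sum>i<n. g i * g i) = 0"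
  proof (rule real_quadratic_nonneg_linear_zero)
    fix x
    define k where "k = (\<lambda>i. h i + x * g i)"
    have "edge_form n J k k = edge_form n J h h + 2 * x * edge_form n J g h
            + x\<^sup>2 * edge_form n J g g"
      unfolding edge_form_def sum_distrib_left sum.distrib[symmetric]
      by (intro sum.cong refl) (simp add: k_def algebra_simps power2_eq_square)
    moreover have "vertex_form n J k k = vertex_form n J h h + 2 * x * vertex_form n J g h
            + x\<^sup>2 * vertex_form n J g g"
      unfolding vertex_form_def sum_distrib_left sum.distrib[symmetric]
      by (intro sum.cong refl) (simp add: k_def algebra_simps power2_eq_square)
    ultimately show "0 \<le> 2 * x * (\<Sum>i<n. g i * g i)
        + x\<^sup>2 * (l * vertex_form n J g g - edge_form n J g g)"
      using bound[of k] eh unfolding gsum by (simp add: algebra_simps)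
  qed
  then have "\<forall>i\<in>{..<n}. g i * g i = 0"
    by (subst (asm) sum_nonneg_eq_0_iff) auto
  then have eig: "neighbour_sum n J h i = l * (vertex_weight n J i * h i)" if "i < n" for i
    using that by (simp add: g_def)
  have h_nonneg: "0 \<le> h i" for i by (simp add: h_def)
  have "0 < h i" if i: "i < n" for i
  proof (rule ccontr)
    assume "\<not> 0 < h i"
    then have "h i = 0" using h_nonneg[of i] by simp
    have "h j = 0" if "j < n" for j
    proof (rule cyclic_induct[where P = "\<lambda>j. h j = 0", OF i \<open>h i = 0\<close> _ that])
      \<comment> \<open>At a zero of \<open>h\<close> the equation makes a sum of two nonnegative
        terms vanish, so the zero spreads to the next vertex.\<close>
      fix k assume k: "k < n" "h k = 0"
      have "neighbour_sum n J h k = 0" using eig[OF k(1)] k(2) by simp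
      then show "h (succ_mod n k) = 0"
        using h_nonneg[of "pred_mod n k"] h_nonneg[of "succ_mod n k"]
          sinh_pos[OF k(1)] sinh_pos[OF pred_mod_less[OF k(1)]]
        by (simp add: neighbour_sum_def add_nonneg_eq_0_iff)
    qed
    then have "vertex_form n J h h = 0" by (simp add: vertex_form_eq_sum)
    with h0(1) vh show False by simp
  qed
  note h_pos = this
  have "0 < edge_form n J h h"
    unfolding edge_form_def using n
    by (intro sum_pos mult_pos_pos add_pos_pos sinh_pos h_pos succ_mod_less) auto
  then have "0 < l" using eh h0(1) vh by (simp add: zero_less_mult_iff)
  \<comment> \<open>Edge by edge, from \<open>sinh < cosh\<close> and the inequality of arithmetic
    and geometric means.\<close>
  have "edge_form n J h h < vertex_form n J h h"
    unfolding edge_form_def vertex_form_def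
  proof (rule sum_strict_mono)
    fix i assume "i \<in> {..<n}"
    then have i: "i < n" by simp
    let ?a = "h i" and ?b = "h (succ_mod n i)"
    have pos: "0 < ?a * ?b + ?b * ?a"
      by (intro add_pos_pos mult_pos_pos h_pos succ_mod_less i)
    have "sinh (2 * J i) < cosh (2 * J i)" by (simp add: sinh_less_cosh_real)
    then have "sinh (2 * J i) * (?a * ?b + ?b * ?a) < cosh (2 * J i) * (?a * ?b + ?b * ?a)"
      using pos by (rule mult_strict_right_mono)
    also have "\<dots> \<le> cosh (2 * J i) * (?a * ?a + ?b * ?b)"
      using sum_squares_bound[of ?a ?b]
      by (intro mult_left_mono) (auto simp: power2_eq_square)
    finally show "sinh (2 * J i) * (?a * ?b + ?b * ?a) < cosh (2 * J i) * (?a * ?a + ?b * ?b)" .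
  qed (use n in auto)
  then have "l < 1" using eh h0(1) vh by simp
  show ?thesis
    by (rule that[of l h]) (simp add: perron_pair_def \<open>0 < l\<close> \<open>l < 1\<close> h_pos eig)
qed

subsection \<open>Monotonicity of the top eigenvalue\<close>

text \<open>At an index \<open>k\<close> minimizing \<open>a\<close>, the assumption
  \<open>a k <= 0\<close> would give \<open>a k <= t k * a k <= t k * a (s k) < a k\<close>. The map
  \<open>s\<close> is left free so that the cycle can be traversed in both directions.\<close>

lemma cyclic_recursion_pos:
  fixes a :: "nat \<Rightarrow> real"
  assumes t: "\<And>i. i < n \<Longrightarrow> 0 \<le> t i" "\<And>i. i < n \<Longrightarrow> t i \<le> 1"
    and s: "\<And>i. i < n \<Longrightarrow> s i < n"
    and rec: "\<And>i. i < n \<Longrightarrow> t i * a (s i) < a i"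
    and i: "i < n"
  shows "0 < a i"
proof -
  have "finite (a ` {..<n})" "a ` {..<n} \<noteq> {}" using i by auto
  from Min_in[OF this] obtain k where k: "k < n" "a k = Min (a ` {..<n})" by auto
  have min: "a k \<le> a j" if "j < n" for j
    using that k by simp
  have "0 < a k"
  proof (rule ccontr)
    assume "\<not> 0 < a k"
    then have "a k \<le> t k * a k"
      using t(2)[OF k(1)] by (simp add: mult_le_cancel_right1 not_less)
    also have "\<dots> \<le> t k * a (s k)"
      using min[OF s[OF k(1)]] t(1)[OF k(1)] by (rule mult_left_mono)
    finally show False using rec[OF k(1)] by simp
  qed
  then show ?thesis using min[OF i] by linarith
qed

text \<open>The two bounds are mirror images: \<open>cyclic_recursion_pos\<close> is applied once
  along the cycle and once against it.\<close>

lemma perron_pair_ratio: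
  assumes J: "\<And>i. i < n \<Longrightarrow> 0 < J i" and P: "perron_pair n J l h" and i: "i < n"
  shows "tanh (J i) * h i \<le> h (succ_mod n i)"
    and "tanh (J i) * h (succ_mod n i) \<le> h i"
proof -
  have tanh: "0 \<le> tanh (J i)" "tanh (J i) \<le> 1" if "i < n" for i
    using J[OF that] tanh_real_lt_1[of "J i"] by (auto simp: less_imp_le)
  define c where "c = (\<lambda>i. cosh (J i))"
  define s where "s = (\<lambda>i. sinh (J i))"
  have c_pos: "0 < c i" for i by (simp add: c_def)
  have ts: "tanh (J i) * c i = s i" for i
    by (simp add: tanh_def c_def s_def)
  have ts': "tanh (J i) * (c i * x) = s i * x" for i x
    unfolding ts[symmetric] by (rule mult.assoc[symmetric])
  \<comment> \<open>As \<open>l < 1\<close>, the equation at \<open>k\<close> leaves a positive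
    surplus, which splits into one bracket for each of the two edges at \<open>k\<close>. Using
    opposite forms of the double-angle formula for these edges makes the constants cancel.\<close>
  have defect: "c p * (c p * h k - s p * h p) - s k * (c k * h (succ_mod n k) - s k * h k) > 0"
    if "k < n" "p = pred_mod n k" for k p
  proof -
    have "0 < (1 - l) * (vertex_weight n J k * h k)"
      using P that vertex_weight_pos[of n J k] by (auto simp: perron_pair_def)
    also have "\<dots> = vertex_weight n J k * h k - neighbour_sum n J h k"
      using P that by (simp add: perron_pair_def algebra_simps)
    also have "\<dots> = 2 * (c p * (c p * h k - s p * h p) - s k * (c k * h (succ_mod n k) - s k * h k))"
    proof -
      have cosh2: "cosh (2 * J p) = 2 * (c p * c p) - 1" "cosh (2 * J k) = 2 * (s k * s k) + 1"
        by (simp_all add: cosh_double cosh_square_eq c_def s_def flip: power2_eq_square)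
      have sinh2: "sinh (2 * J i) = 2 * (s i * c i)" for i
        by (simp add: sinh_double c_def s_def)
      show ?thesis
        unfolding vertex_weight_def neighbour_sum_def that(2)[symmetric] cosh2 sinh2
        by (simp add: algebra_simps)
    qed
    finally show ?thesis by simp
  qed
  \<comment> \<open>The same surplus with the coefficient of \<open>h k\<close> rewritten by
    \<open>cosh^2 - sinh^2 = 1\<close> at both edges; this suits the reverse direction.\<close>
  have defect': "c k * (c k * h k - s k * h (succ_mod n k)) - s p * (c p * h p - s p * h k) > 0"
    if "k < n" "p = pred_mod n k" for k p
  proof -
    have "c k * c k + s p * s p - (c p * c p + s k * s k) = 0"
      by (simp add: c_def s_def cosh_square_eq flip: power2_eq_square)
    then have "(c k * c k + s p * s p - (c p * c p + s k * s k)) * h k = 0" by simp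
    with defect[OF that] show ?thesis
      by (simp add: algebra_simps)
  qed
  have "0 < c i * (c i * h (succ_mod n i) - s i * h i)"
  proof (rule cyclic_recursion_pos[where s = "succ_mod n"
        and a = "\<lambda>k. c k * (c k * h (succ_mod n k) - s k * h k)" and t = "\<lambda>j. tanh (J (succ_mod n j))" and n = n])
    fix k assume k: "k < n"
    show "tanh (J (succ_mod n k)) *
         (c (succ_mod n k) * (c (succ_mod n k) * h (succ_mod n (succ_mod n k)) - s (succ_mod n k) * h (succ_mod n k)))
         < c k * (c k * h (succ_mod n k) - s k * h k)"
      unfolding ts' using defect[of "succ_mod n k" k] k by (simp add: succ_mod_less)
  qed (use i in \<open>auto simp: succ_mod_less tanh J less_imp_le\<close>)
  then have "tanh (J i) * c i * h i \<le> c i * h (succ_mod n i)"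
    using c_pos[of i] by (simp add: zero_less_mult_iff ts)
  then show "tanh (J i) * h i \<le> h (succ_mod n i)"
    using c_pos[of i] by (simp add: mult.assoc mult.left_commute[of _ "c i"])
  have "0 < c i * (c i * h i - s i * h (succ_mod n i))"
  proof (rule cyclic_recursion_pos[where s = "pred_mod n"
        and a = "\<lambda>k. c k * (c k * h k - s k * h (succ_mod n k))" and t = "\<lambda>j. tanh (J (pred_mod n j))" and n = n])
    fix k assume k: "k < n"
    show "tanh (J (pred_mod n k)) *
         (c (pred_mod n k) * (c (pred_mod n k) * h (pred_mod n k) - s (pred_mod n k) * h (succ_mod n (pred_mod n k))))
         < c k * (c k * h k - s k * h (succ_mod n k))"
      unfolding ts' using defect'[of k "pred_mod n k"] k by simp
  qed (use i in \<open>auto simp: pred_mod_less tanh J less_imp_le\<close>)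
  then have "tanh (J i) * c i * h (succ_mod n i) \<le> c i * h i"
    using c_pos[of i] by (simp add: zero_less_mult_iff ts)
  then show "tanh (J i) * h (succ_mod n i) \<le> h i"
    using c_pos[of i] by (simp add: mult.assoc mult.left_commute[of _ "c i"])
qed

text \<open>For \<open>s = tanh (J i)\<close> and \<open>t = tanh (J' i)\<close>, the quotient
  \<open>(s + t) / (1 + s * t)\<close> is \<open>tanh (J i + J' i)\<close>: the ratio bounds of the
  two eigenvectors combine into one for the sum of the couplings.\<close>

lemma tanh_add_bilinear:
  fixes a b a' b' s t :: real
  assumes "s * a \<le> b" "s * b \<le> a" "t * a' \<le> b'" "t * b' \<le> a'"
  shows "(s + t) * (a * a' + b * b') \<le> (1 + s * t) * (a * b' + b * a')"
proof -
  have "0 \<le> (a - s * b) * (b' - t * a') + (b - s * a) * (a' - t * b')"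
    using assms by (intro add_nonneg_nonneg mult_nonneg_nonneg) auto
  also have "\<dots> = (1 + s * t) * (a * b' + b * a') - (s + t) * (a * a' + b * b')"
    by (simp add: algebra_simps)
  finally show ?thesis by simp
qed

lemma perron_pair_mono:
  assumes J: "\<And>i. i < n \<Longrightarrow> 0 < J i" and le: "\<And>i. i < n \<Longrightarrow> J i \<le> J' i"
    and P: "perron_pair n J l h" and P': "perron_pair n J' l' h'" and n: "0 < n"
  shows "l \<le> l'"
proof -
  have J': "0 < J' i" if "i < n" for i using J[OF that] le[OF that] by simp
  have "edge_form n J h' h = l * vertex_form n J h' h"
    unfolding edge_form_eq_sum vertex_form_eq_sum sum_distrib_left
    using P by (intro sum.cong) (auto simp: perron_pair_def)
  moreover have "edge_form n J' h h' = l' * vertex_form n J' h h'"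
    unfolding edge_form_eq_sum vertex_form_eq_sum sum_distrib_left
    using P' by (intro sum.cong) (auto simp: perron_pair_def)
  moreover have "edge_form n J h' h = edge_form n J h h'" "vertex_form n J h' h = vertex_form n J h h'"
    by (simp_all add: edge_form_def vertex_form_def algebra_simps)
  \<comment> \<open>Both forms are symmetric, so the two eigenvector equations can be tested against
    each other and subtracted.\<close>
  ultimately have id: "(l' - l) * vertex_form n J h h' =
      (edge_form n J' h h' - edge_form n J h h') - l' * (vertex_form n J' h h' - vertex_form n J h h')"
    by (simp add: algebra_simps)
  have "l' * (vertex_form n J' h h' - vertex_form n J h h') \<le> edge_form n J' h h' - edge_form n J h h'"
    unfolding edge_form_def vertex_form_def sum_subtractf[symmetric] sum_distrib_left
  proof (rule sum_mono)
    fix i assume "i \<in> {..<n}"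
    then have i: "i < n" by simp
    let ?j = "succ_mod n i"
    let ?X = "h i * h' ?j + h ?j * h' i" and ?Y = "h i * h' i + h ?j * h' ?j"
    have pos: "0 < h i" "0 < h ?j" "0 < h' i" "0 < h' ?j"
      using P P' i by (auto simp: perron_pair_def succ_mod_less)
    have *: "(tanh (J i) + tanh (J' i)) * ?Y \<le> (1 + tanh (J i) * tanh (J' i)) * ?X"
      by (intro tanh_add_bilinear perron_pair_ratio[OF J P i] perron_pair_ratio[OF J' P' i])
    have "sinh (J i + J' i) = cosh (J i) * cosh (J' i) * (tanh (J i) + tanh (J' i))"
      "cosh (J i + J' i) = cosh (J i) * cosh (J' i) * (1 + tanh (J i) * tanh (J' i))"
      by (simp_all add: sinh_add cosh_add tanh_def field_simps)
    then have **: "sinh (J i + J' i) * ?Y \<le> cosh (J i + J' i) * ?X"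
      using mult_left_mono[OF *, of "cosh (J i) * cosh (J' i)"] by (simp add: mult.assoc)
    \<comment> \<open>By the sum-to-product formulas, passing from \<open>J\<close> to
      \<open>J'\<close> changes the \<open>sinh\<close> weight by
      \<open>d * cosh (J i + J' i)\<close> and the \<open>cosh\<close> weight by
      \<open>d * sinh (J i + J' i)\<close>. Then \<open>**\<close> and \<open>l' < 1\<close> decide
      the sign.\<close>
    define d where "d = 2 * sinh (J' i - J i)"
    have d: "0 \<le> d" using le[OF i] by (simp add: d_def)
    have J2: "2 * J' i = (J i + J' i) + (J' i - J i)" "2 * J i = (J i + J' i) - (J' i - J i)"
      by simp_all
    have S: "sinh (2 * J' i) - sinh (2 * J i) = d * cosh (J i + J' i)"
      unfolding J2 sinh_add[of "J i + J' i"] sinh_diff[of "J i + J' i"] d_def by simp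
    have C: "cosh (2 * J' i) - cosh (2 * J i) = d * sinh (J i + J' i)"
      unfolding J2 cosh_add[of "J i + J' i"] cosh_diff[of "J i + J' i"] d_def by simp
    have nn: "0 \<le> d * (sinh (J i + J' i) * ?Y)"
      using d J[OF i] J'[OF i] pos by (auto intro!: mult_nonneg_nonneg add_nonneg_nonneg)
    have "l' * (cosh (2 * J' i) * ?Y - cosh (2 * J i) * ?Y) = l' * (d * (sinh (J i + J' i) * ?Y))"
      using C by (metis left_diff_distrib mult.assoc)
    also have "\<dots> \<le> 1 * (d * (sinh (J i + J' i) * ?Y))"
      using P' nn by (intro mult_right_mono) (auto simp: perron_pair_def)
    also have "\<dots> \<le> d * (cosh (J i + J' i) * ?X)"
      using mult_left_mono[OF ** d] by simp
    also have "\<dots> = sinh (2 * J' i) * ?X - sinh (2 * J i) * ?X"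
      using S by (metis left_diff_distrib mult.assoc)
    finally show "l' * (cosh (2 * J' i) * ?Y - cosh (2 * J i) * ?Y)
      \<le> sinh (2 * J' i) * ?X - sinh (2 * J i) * ?X" .
  qed
  then have "0 \<le> (l' - l) * vertex_form n J h h'" unfolding id by simp
  moreover have "0 < vertex_form n J h h'"
    unfolding vertex_form_def
    using n P P' by (intro sum_pos mult_pos_pos add_pos_pos)
      (auto simp: perron_pair_def succ_mod_less)
  ultimately show ?thesis by (simp add: zero_le_mult_iff)
qed

subsection \<open>Stochastic matrices\<close>

text \<open>The constants form an invariant line. In a basis containing the all-one vector the
  matrix is block upper triangular, with blocks 1 and the matrix induced on the quotient by the
  constants; subtracting row 0 realizes this quotient.\<close>

lemma char_poly_row_sums_one:
  fixes A :: "real mat"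
  assumes A: "A \<in> carrier_mat (Suc m) (Suc m)"
    and rows: "\<And>i. i < Suc m \<Longrightarrow> (\<Sum>j<Suc m. A $$ (i, j)) = 1"
  shows "char_poly A = [:- 1, 1:] *
    char_poly (mat m m (\<lambda>(i, j). A $$ (Suc i, Suc j) - A $$ (0, Suc j)))"
proof -
  define B where "B = mat m m (\<lambda>(i, j). A $$ (Suc i, Suc j) - A $$ (0, Suc j))"
  define C where "C = four_block_mat (1\<^sub>m 1) (mat 1 m (\<lambda>(i, j). A $$ (0, Suc j))) (0\<^sub>m m 1) B"
  \<comment> \<open>change of basis replacing the first unit vector by the all-one vector, which \<open>A\<close> fixes\<close>
  define P where "P = mat (Suc m) (Suc m) (\<lambda>(i, j). if i = j \<or> j = 0 then 1 else 0 :: real)"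
  define Q where "Q = mat (Suc m) (Suc m) (\<lambda>(i, j). if i = j then 1 else if j = 0 then - 1 else 0 :: real)"
  have carr: "C \<in> carrier_mat (Suc m) (Suc m)" "P \<in> carrier_mat (Suc m) (Suc m)"
    "Q \<in> carrier_mat (Suc m) (Suc m)"
    by (auto simp: C_def P_def Q_def B_def)
  have P_mult: "(P * X) $$ (i, j) = X $$ (i, j) + (if i = 0 then 0 else X $$ (0, j))"
    if X: "X \<in> carrier_mat (Suc m) (Suc m)" and ij: "i < Suc m" "j < Suc m" for X i j
  proof -
    have "(P * X) $$ (i, j) = (\<Sum>k<Suc m. (if i = k \<or> k = 0 then 1 else 0) * X $$ (k, j))"
      using X ij by (auto simp: P_def scalar_prod_def atLeast0LessThan intro!: sum.cong)
    also have "\<dots> = (\<Sum>k<Suc m. (if k = i then X $$ (k, j) else 0) +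
        (if k = 0 then (if i = 0 then 0 else X $$ (k, j)) else 0))"
      by (intro sum.cong) auto
    also have "\<dots> = X $$ (i, j) + (if i = 0 then 0 else X $$ (0, j))"
      using ij by (simp only: sum.distrib sum.delta finite_lessThan) auto
    finally show ?thesis .
  qed
  have PQ: "P * Q = 1\<^sub>m (Suc m)"
  proof (rule eq_matI)
    fix i j assume "i < dim_row (1\<^sub>m (Suc m) :: real mat)" "j < dim_col (1\<^sub>m (Suc m) :: real mat)"
    then show "(P * Q) $$ (i, j) = 1\<^sub>m (Suc m) $$ (i, j)"
      using carr by (subst P_mult) (auto simp: Q_def)
  qed (use carr in auto)
  then have QP: "Q * P = 1\<^sub>m (Suc m)"
    using mat_mult_left_right_inverse carr by blast
  have C_index: "C $$ (i, j) = (if i = 0 then if j = 0 then 1 else A $$ (0, j)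
      else if j = 0 then 0 else A $$ (i, j) - A $$ (0, j))"
    if "i < Suc m" "j < Suc m" for i j
    using that by (cases i; cases j) (auto simp: C_def B_def)
  have "A * P = P * C"
  proof (rule eq_matI)
    fix i j assume "i < dim_row (P * C)" "j < dim_col (P * C)"
    then have ij: "i < Suc m" "j < Suc m" using carr by auto
    have "(A * P) $$ (i, j) = (\<Sum>k<Suc m. A $$ (i, k) * (if k = j \<or> j = 0 then 1 else 0))"
      using A ij by (auto simp: P_def scalar_prod_def atLeast0LessThan intro!: sum.cong)
    also have "\<dots> = (if j = 0 then 1 else A $$ (i, j))"
    proof (cases "j = 0")
      case True
      then show ?thesis using rows[OF ij(1)] by simp
    next
      case False
      then have "(\<Sum>k<Suc m. A $$ (i, k) * (if k = j \<or> j = 0 then 1 else 0)) =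
          (\<Sum>k<Suc m. if k = j then A $$ (i, k) else 0)"
        by (intro sum.cong) auto
      with False ij show ?thesis by (simp only: sum.delta finite_lessThan) auto
    qed
    also have "\<dots> = (P * C) $$ (i, j)"
      using ij by (subst P_mult[OF carr(1)]) (auto simp: C_index)
    finally show "(A * P) $$ (i, j) = (P * C) $$ (i, j)" .
  qed (use A carr in auto)
  then have "P * C * Q = A * (P * Q)"
    using A carr by (metis assoc_mult_mat)
  then have "A = P * C * Q" using A PQ by simp
  then have "similar_mat A C"
    using A carr by (intro similar_matI[OF _ PQ QP]) auto
  then have "char_poly A = char_poly C" by (rule char_poly_similar)
  also have "\<dots> = char_poly (1\<^sub>m 1) * char_poly B"
    unfolding C_def by (rule char_poly_four_block_zeros_col) (auto simp: B_def)
  also have "char_poly (1\<^sub>m 1 :: real mat) = [:- 1, 1:]"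
    by (subst char_poly_upper_triangular[of _ 1]) (auto simp: diag_mat_def)
  finally show ?thesis unfolding B_def .
qed

text \<open>A sorted list is determined by its multiset, so it suffices to exhibit one ending in
  \<open>y, x\<close>. Positions start at 0, so index 1 is the second entry; \<open>x = y\<close> is
  allowed.\<close>

lemma second_entry_rev_sorted_list_of_multiset:
  fixes x y :: "'a :: linorder"
  assumes "\<And>z. z \<in># M \<Longrightarrow> z \<le> y" "y \<in># M" "y \<le> x"
  shows "rev (sorted_list_of_multiset (add_mset x M)) ! 1 = y"
proof -
  let ?xs = "sorted_list_of_multiset (M - {#y#})"
  have "z \<le> y" if "z \<in> set ?xs" for z
    using that assms(1) by (auto dest: in_diffD)
  then have "sorted (?xs @ [y, x])"
    using assms(3) by (fastforce simp: sorted_append)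
  moreover have "mset (?xs @ [y, x]) = add_mset x M"
    using assms(2) by simp
  ultimately have "sorted_list_of_multiset (add_mset x M) = ?xs @ [y, x]"
    by (metis sorted_list_of_multiset_mset sorted_sort_id)
  then show ?thesis by simp
qed

text \<open>
  The additive constant in the last assumption accounts for the passage to the quotient by the
  constant vectors: an eigenvector of the quotient lifts only to such a \<open>u\<close>.  The case \<open>r = 1\<close>
  excludes a multiple root 1.
\<close>

lemma second_eigenvalue_row_sums_one:
  fixes A :: "real mat"
  assumes A: "A \<in> carrier_mat N N" and N: "0 < N"
    and rows: "\<And>i. i < N \<Longrightarrow> (\<Sum>j<N. A $$ (i, j)) = 1"
    and eig: "v \<in> carrier_vec N" "v \<noteq> 0\<^sub>v N" "A *\<^sub>v v = e \<cdot>\<^sub>v v" and "e < 1"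
    and top: "\<And>u r c. e < r \<Longrightarrow> (\<And>i. i < N \<Longrightarrow> (\<Sum>j<N. A $$ (i, j) * u j) = r * u i + c) \<Longrightarrow>
        (\<And>i. i < N \<Longrightarrow> u i = u 0)"
  shows "rev (sorted_list_of_multiset (proots (char_poly A))) ! 1 = e"
proof -
  obtain m where m: "N = Suc m" using N by (cases N) auto
  define B where "B = mat m m (\<lambda>(i, j). A $$ (Suc i, Suc j) - A $$ (0, Suc j))"
  have B: "B \<in> carrier_mat m m" by (simp add: B_def)
  have cp: "char_poly A = [:- 1, 1:] * char_poly B"
    unfolding B_def using A rows unfolding m by (rule char_poly_row_sums_one)
  have B0: "char_poly B \<noteq> 0"
    using degree_monic_char_poly[OF B] by auto
  then have roots: "proots (char_poly A) = add_mset 1 (proots (char_poly B))"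
    unfolding cp by (subst proots_mult) auto
  have "eigenvalue A e"
    using A eig by (auto simp: eigenvalue_def eigenvector_def)
  then have "poly (char_poly A) e = 0"
    using eigenvalue_root_char_poly[OF A] by simp
  then have "e \<in># proots (char_poly B)"
    using \<open>e < 1\<close> B0 by (simp add: cp)
  moreover have "r \<le> e" if "r \<in># proots (char_poly B)" for r
  proof (rule ccontr)
    assume "\<not> r \<le> e"
    have "poly (char_poly B) r = 0" using that B0 by simp
    then obtain x where x: "x \<in> carrier_vec m" "x \<noteq> 0\<^sub>v m" "B *\<^sub>v x = r \<cdot>\<^sub>v x"
      using eigenvalue_root_char_poly[OF B] B by (auto simp: eigenvalue_def eigenvector_def)
    \<comment> \<open>Lift of the quotient eigenvector to the representative vanishing at 0. It
      satisfies the eigenvalue equation only up to \<open>c\<close>, the value of row 0 on the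
      lift.\<close>
    define u where "u i = (case i of 0 \<Rightarrow> 0 | Suc k \<Rightarrow> x $ k)" for i
    define c where "c = (\<Sum>k<m. A $$ (0, Suc k) * x $ k)"
    have "u i = u 0" if "i < N" for i
    proof (rule top[of r _ c])
      fix i assume i: "i < N"
      have sum: "(\<Sum>j<N. A $$ (i, j) * u j) = (\<Sum>k<m. A $$ (i, Suc k) * x $ k)"
        unfolding m by (subst sum.lessThan_Suc_shift) (simp add: u_def)
      show "(\<Sum>j<N. A $$ (i, j) * u j) = r * u i + c"
      proof (cases i)
        case 0
        then show ?thesis unfolding sum by (simp add: c_def u_def)
      next
        case (Suc k)
        then have k: "k < m" using i m by simp
        have "r * x $ k = (B *\<^sub>v x) $ k" using x k by simp
        also have "\<dots> = (\<Sum>j<m. (A $$ (Suc k, Suc j) - A $$ (0, Suc j)) * x $ j)"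
          using x(1) k by (auto simp: B_def scalar_prod_def atLeast0LessThan intro!: sum.cong)
        finally show ?thesis
          unfolding sum c_def by (simp add: Suc u_def left_diff_distrib sum_subtractf)
      qed
    qed (use \<open>\<not> r \<le> e\<close> that in auto)
    from this[of "Suc _"] have "x $ k = 0" if "k < m" for k
      using that by (simp add: u_def m)
    then have "x = 0\<^sub>v m" using x(1) by (intro eq_vecI) auto
    with x(2) show False by simp
  qed
  ultimately show ?thesis
    unfolding roots using \<open>e < 1\<close>
    by (intro second_entry_rev_sorted_list_of_multiset) auto
qed

subsection \<open>Glauber dynamics\<close>

lemma configs_cases: "\<sigma> \<in> configs n \<Longrightarrow> i < n \<Longrightarrow> \<sigma> i = 1 \<or> \<sigma> i = - 1"
  by (auto simp: configs_def PiE_def Pi_def)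

lemma fun_upd_configs: "\<sigma> \<in> configs n \<Longrightarrow> i < n \<Longrightarrow> x = 1 \<or> x = - 1 \<Longrightarrow> \<sigma>(i := x) \<in> configs n"
  by (auto simp: configs_def PiE_def Pi_def extensional_def)

lemma flip_configs: "\<sigma> \<in> configs n \<Longrightarrow> i < n \<Longrightarrow> flip i \<sigma> \<in> configs n"
  unfolding flip_def using configs_cases by (intro fun_upd_configs) fastforce+

lemma flip_neq: "\<sigma> \<in> configs n \<Longrightarrow> i < n \<Longrightarrow> flip i \<sigma> \<noteq> \<sigma>"
  using configs_cases[of \<sigma> n i] by (auto simp: flip_def fun_upd_idem_iff)

lemma inj_on_flip: "\<sigma> \<in> configs n \<Longrightarrow> inj_on (\<lambda>i. flip i \<sigma>) {..<n}"
proof (rule inj_onI)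
  fix i j assume \<sigma>: "\<sigma> \<in> configs n" and ij: "i \<in> {..<n}" "j \<in> {..<n}" "flip i \<sigma> = flip j \<sigma>"
  show "i = j"
  proof (rule ccontr)
    assume "i \<noteq> j"
    then have "- \<sigma> i = \<sigma> i"
      using fun_cong[OF ij(3), of i] by (simp add: flip_def)
    then show False using configs_cases[OF \<sigma>, of i] ij(1) by auto
  qed
qed

lemma finite_configs: "finite (configs n)"
  by (simp add: configs_def finite_PiE)

section \<open>Heat-bath updates as conditional expectations\<close>

definition local_field :: "nat \<Rightarrow> (nat \<Rightarrow> real) \<Rightarrow> nat \<Rightarrow> config \<Rightarrow> real" where
  "local_field n J i \<sigma> = J (pred_mod n i) * \<sigma> (pred_mod n i) + J i * \<sigma> (succ_mod n i)"

text \<open>The conditional Gibbs probability of spin 1 at \<open>i\<close> given the other spins;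
  \<open>local_field\<close> is half its log-odds.\<close>

definition plus_prob :: "nat \<Rightarrow> (nat \<Rightarrow> real) \<Rightarrow> nat \<Rightarrow> config \<Rightarrow> real" where
  "plus_prob n J i \<sigma> = 1 / (1 + exp (- 2 * local_field n J i \<sigma>))"

definition heat_bath :: "nat \<Rightarrow> (nat \<Rightarrow> real) \<Rightarrow> nat \<Rightarrow> (config \<Rightarrow> real) \<Rightarrow> config \<Rightarrow> real" where
  "heat_bath n J i g \<sigma> =
     plus_prob n J i \<sigma> * g (\<sigma>(i := 1)) + (1 - plus_prob n J i \<sigma>) * g (\<sigma>(i := - 1))"

lemma weight_flip:
  assumes n: "n \<ge> 3" and i: "i < n"
  shows "weight n J (flip i \<sigma>) = weight n J \<sigma> * exp (- 2 * \<sigma> i * local_field n J i \<sigma>)"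
proof -
  let ?e = "\<lambda>\<tau> k. J k * \<tau> k * \<tau> (succ_mod n k)"
  have p: "pred_mod n i < n" "pred_mod n i \<noteq> i" "succ_mod n i \<noteq> i"
    using n i by (auto simp: pred_mod_less pred_mod_neq succ_mod_neq)
  have succ_eq: "succ_mod n k = i \<longleftrightarrow> k = pred_mod n i" if "k < n" for k
    using that i by auto
  \<comment> \<open>The flip reverses exactly the terms of the two edges meeting \<open>i\<close>,
    numbered \<open>i\<close> and \<open>pred_mod n i\<close>.\<close>
  have "(\<Sum>k<n. ?e (flip i \<sigma>) k) = (\<Sum>k<n. ?e \<sigma> k
      + (if k = i then - 2 * \<sigma> i * (J i * \<sigma> (succ_mod n i)) else 0)
      + (if k = pred_mod n i then - 2 * \<sigma> i * (J k * \<sigma> k) else 0))"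
    using p by (intro sum.cong refl) (auto simp: flip_def succ_eq i algebra_simps)
  also have "\<dots> = (\<Sum>k<n. ?e \<sigma> k) + - 2 * \<sigma> i * local_field n J i \<sigma>"
    using p(1) i by (simp add: sum.distrib local_field_def algebra_simps)
  finally show ?thesis
    by (simp add: weight_def succ_mod_def exp_diff exp_minus divide_inverse)
qed

lemma update_prob_flip:
  assumes n: "n \<ge> 3" and i: "i < n"
  shows "update_prob n J \<sigma> (flip i \<sigma>) = 1 / n * (1 / (1 + exp (2 * \<sigma> i * local_field n J i \<sigma>)))"
proof -
  let ?Z = "\<Sum>\<tau>\<in>configs n. weight n J \<tau>" and ?E = "exp (2 * \<sigma> i * local_field n J i \<sigma>)"
  have "0 < weight n J \<sigma>" by (simp add: weight_def)
  have "configs n \<noteq> {}" by (simp add: configs_def PiE_eq_empty_iff)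
  then have "0 < ?Z" by (intro sum_pos finite_configs) (auto simp: weight_def)
  have w: "weight n J \<sigma> = weight n J (flip i \<sigma>) * ?E"
    by (simp add: weight_flip[OF n i] mult.assoc flip: exp_add)
  have W: "0 < weight n J (flip i \<sigma>)" by (simp add: weight_def)
  have "0 < 1 + ?E" by (simp add: add_pos_pos)
  have "gibbs n J (flip i \<sigma>) / (gibbs n J \<sigma> + gibbs n J (flip i \<sigma>)) =
     weight n J (flip i \<sigma>) / (weight n J \<sigma> + weight n J (flip i \<sigma>))"
    unfolding gibbs_def using \<open>0 < ?Z\<close> by (simp flip: add_divide_distrib)
  also have "\<dots> = weight n J (flip i \<sigma>) * 1 / (weight n J (flip i \<sigma>) * (1 + ?E))"
    by (subst w) (simp add: algebra_simps)
  also have "\<dots> = 1 / (1 + ?E)"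
    using W by (subst mult_divide_mult_cancel_left) auto
  finally show ?thesis by (simp add: update_prob_def)
qed

text \<open>One step resamples a uniformly chosen site. The diagonal entry collects the updates that
  leave the spin unchanged, so the row is first written as \<open>g \<sigma>\<close> plus weighted
  differences, one for each site.\<close>

lemma glauber_sum_eq_heat_bath:
  assumes n: "n \<ge> 3" and \<sigma>: "\<sigma> \<in> configs n"
  shows "(\<Sum>\<tau>\<in>configs n. glauber n J \<sigma> \<tau> * g \<tau>) = (\<Sum>i<n. heat_bath n J i g \<sigma>) / n"
proof -
  let ?F = "(\<lambda>i. flip i \<sigma>) ` {..<n}" and ?u = "\<lambda>i. update_prob n J \<sigma> (flip i \<sigma>)"
  have "(\<Sum>\<tau>\<in>configs n. glauber n J \<sigma> \<tau> * g \<tau>) = (\<Sum>\<tau>\<in>insert \<sigma> ?F. glauber n J \<sigma> \<tau> * g \<tau>)"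
    using \<sigma> flip_configs finite_configs
    by (intro sum.mono_neutral_right) (auto simp: glauber_def)
  also have "\<dots> = glauber n J \<sigma> \<sigma> * g \<sigma> + (\<Sum>\<tau>\<in>?F. glauber n J \<sigma> \<tau> * g \<tau>)"
    using flip_neq[OF \<sigma>] by (subst sum.insert) fastforce+
  also have "(\<Sum>\<tau>\<in>?F. glauber n J \<sigma> \<tau> * g \<tau>) = (\<Sum>i<n. ?u i * g (flip i \<sigma>))"
    using flip_neq[OF \<sigma>] by (subst sum.reindex[OF inj_on_flip[OF \<sigma>]])
      (auto simp: glauber_def intro!: sum.cong)
  also have "glauber n J \<sigma> \<sigma> * g \<sigma> + (\<Sum>i<n. ?u i * g (flip i \<sigma>)) =
      g \<sigma> + (\<Sum>i<n. ?u i * (g (flip i \<sigma>) - g \<sigma>))"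
    by (simp add: glauber_def right_diff_distrib sum_subtractf sum_distrib_right left_diff_distrib)
  also have "(\<Sum>i<n. ?u i * (g (flip i \<sigma>) - g \<sigma>)) = (\<Sum>i<n. (heat_bath n J i g \<sigma> - g \<sigma>) / n)"
  proof (intro sum.cong refl)
    fix i assume "i \<in> {..<n}"
    then have i: "i < n" by simp
    let ?x = "local_field n J i \<sigma>"
    have nz: "1 + exp (- 2 * ?x) \<noteq> 0"
      using exp_gt_zero[of "- 2 * ?x"] by linarith
    have "1 - plus_prob n J i \<sigma> = exp (- 2 * ?x) / (1 + exp (- 2 * ?x))"
      using nz unfolding plus_prob_def by (simp add: diff_divide_eq_iff)
    also have "\<dots> = 1 / (1 + exp (2 * ?x))"
      using exp_gt_zero[of "2 * ?x"] by (simp add: exp_minus field_simps)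
    finally have q: "1 - plus_prob n J i \<sigma> = 1 / (1 + exp (2 * ?x))" .
    from configs_cases[OF \<sigma> i]
    have "heat_bath n J i g \<sigma> - g \<sigma> =
       1 / (1 + exp (2 * \<sigma> i * ?x)) * (g (flip i \<sigma>) - g \<sigma>)"
    proof
      assume s: "\<sigma> i = 1"
      then have "\<sigma>(i := 1) = \<sigma>" "\<sigma>(i := - 1) = flip i \<sigma>" by (auto simp: flip_def)
      then show ?thesis
        using s unfolding heat_bath_def by (simp add: q flip: q) (simp add: algebra_simps)
    next
      assume s: "\<sigma> i = - 1"
      then have "\<sigma>(i := - 1) = \<sigma>" "\<sigma>(i := 1) = flip i \<sigma>" by (auto simp: flip_def)
      then show ?thesis
        using s unfolding heat_bath_def by (simp add: plus_prob_def algebra_simps diff_divide_distrib)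
    qed
    then show "?u i * (g (flip i \<sigma>) - g \<sigma>) = (heat_bath n J i g \<sigma> - g \<sigma>) / n"
      by (simp add: update_prob_flip[OF n i])
  qed
  also have "g \<sigma> + \<dots> = (\<Sum>i<n. heat_bath n J i g \<sigma>) / n"
    using n by (simp add: sum_subtractf diff_divide_distrib flip: sum_divide_distrib)
  finally show ?thesis .
qed

text \<open>Comparable configurations are joined by raising one spin at a time, so this is
  monotonicity for the coordinatewise order.\<close>

definition increasing :: "nat \<Rightarrow> (config \<Rightarrow> real) \<Rightarrow> bool" where
  "increasing n g \<longleftrightarrow> (\<forall>\<sigma>\<in>configs n. \<forall>j<n. g (\<sigma>(j := - 1)) \<le> g (\<sigma>(j := 1)))"

lemma plus_prob_bounds: "0 \<le> plus_prob n J i \<sigma>" "plus_prob n J i \<sigma> \<le> 1"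
  by (simp_all add: plus_prob_def add_pos_nonneg)

text \<open>For \<open>i = j\<close> resampling forgets the changed spin. Otherwise, as the
  couplings are positive, raising spin \<open>j\<close> raises the probability of spin 1 at
  \<open>i\<close>, and it raises \<open>g\<close> for either outcome; the configuration is changed
  first at fixed probability, then the probability.\<close>

lemma heat_bath_mono:
  assumes n: "n \<ge> 3" and J: "\<And>i. i < n \<Longrightarrow> 0 < J i" and g: "increasing n g"
    and \<sigma>: "\<sigma> \<in> configs n" and i: "i < n" and j: "j < n"
  shows "heat_bath n J i g (\<sigma>(j := - 1)) \<le> heat_bath n J i g (\<sigma>(j := 1))"
proof (cases "i = j")
  case True
  then show ?thesis
    using n i by (simp add: heat_bath_def plus_prob_def local_field_def pred_mod_neq succ_mod_neq)
next
  case False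
  let ?a = "\<sigma>(j := - 1)" and ?b = "\<sigma>(j := 1)"
  let ?p = "plus_prob n J i ?a" and ?q = "plus_prob n J i ?b"
  have up: "g (?a(i := x)) \<le> g (?b(i := x))" if "x = 1 \<or> x = - 1" for x
  proof -
    have "g ((\<sigma>(i := x))(j := - 1)) \<le> g ((\<sigma>(i := x))(j := 1))"
      using g fun_upd_configs[OF \<sigma> i that] j by (auto simp: increasing_def)
    then show ?thesis using False by (simp add: fun_upd_twist)
  qed
  have "local_field n J i ?a \<le> local_field n J i ?b"
    unfolding local_field_def using J[OF i] J[OF pred_mod_less[OF i]]
    by (intro add_mono mult_left_mono) auto
  then have pq: "?p \<le> ?q"
    unfolding plus_prob_def by (intro divide_left_mono add_left_mono) (auto simp: add_pos_pos)
  have "g (?b(i := - 1)) \<le> g (?b(i := 1))"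
    using g fun_upd_configs[OF \<sigma> j, of 1] i by (auto simp: increasing_def)
  then have "?p * (g (?b(i := 1)) - g (?b(i := - 1))) \<le> ?q * (g (?b(i := 1)) - g (?b(i := - 1)))"
    using pq by (intro mult_right_mono) auto
  moreover have "?p * g (?a(i := 1)) + (1 - ?p) * g (?a(i := - 1)) \<le>
      ?p * g (?b(i := 1)) + (1 - ?p) * g (?b(i := - 1))"
    using up plus_prob_bounds[of n J i ?a] by (intro add_mono mult_left_mono) auto
  ultimately show ?thesis
    unfolding heat_bath_def by (simp add: algebra_simps)
qed

lemma heat_bath_sum_increasing:
  assumes "n \<ge> 3" "\<And>i. i < n \<Longrightarrow> 0 < J i" "increasing n g"
  shows "increasing n (\<lambda>\<sigma>. (\<Sum>i<n. heat_bath n J i g \<sigma>) / n)"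
  unfolding increasing_def
  using heat_bath_mono[OF assms] by (auto intro!: divide_right_mono sum_mono)

text \<open>The first factor on the left is \<open>tanh (a * s + b * t)\<close>. A function of two
  signs is a combination of 1, \<open>s\<close>, \<open>t\<close> and \<open>s * t\<close>; oddness
  under a joint sign change excludes 1 and \<open>s * t\<close>. The proof checks the four sign
  cases.\<close>

lemma mean_spin_linear:
  fixes a b s t :: real
  assumes "s = 1 \<or> s = - 1" "t = 1 \<or> t = - 1"
  shows "(2 * (1 / (1 + exp (- 2 * (a * s + b * t)))) - 1) * (cosh (2 * a) + cosh (2 * b)) =
    sinh (2 * a) * s + sinh (2 * b) * t"
proof -
  have exps: "exp (- 2 * (a * s + b * t)) = exp (- 2 * (a * s)) * exp (- 2 * (b * t))"
    by (simp flip: exp_add add: algebra_simps)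
  define X where "X = exp (2 * a)"
  define Y where "Y = exp (2 * b)"
  have pos: "0 < X" "0 < Y" by (simp_all add: X_def Y_def)
  then have nz: "X * X + X * Y > 0" "Y + X > 0" "1 + X * Y > 0" by (simp_all add: add_pos_pos)
  have defs: "cosh (2 * a) = (X + 1 / X) / 2" "cosh (2 * b) = (Y + 1 / Y) / 2"
    "sinh (2 * a) = (X - 1 / X) / 2" "sinh (2 * b) = (Y - 1 / Y) / 2"
    by (simp_all add: cosh_def sinh_def X_def Y_def exp_minus field_simps)
  have e: "exp (- (2 * a)) = 1 / X" "exp (- (2 * b)) = 1 / Y" "exp (2 * a) = X" "exp (2 * b) = Y"
    by (simp_all add: X_def Y_def exp_minus field_simps)
  from assms show ?thesis
    unfolding exps defs using pos nz
    by (elim disjE) (simp_all add: e divide_simps, simp_all add: algebra_simps)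
qed

section \<open>Linear observables as eigenfunctions\<close>

definition linear_obs :: "nat \<Rightarrow> (nat \<Rightarrow> real) \<Rightarrow> config \<Rightarrow> real" where
  "linear_obs n w \<sigma> = (\<Sum>k<n. w k * \<sigma> k)"

lemma linear_obs_upd:
  assumes "i < n"
  shows "linear_obs n w (\<sigma>(i := x)) = linear_obs n w \<sigma> + w i * (x - \<sigma> i)"
proof -
  have "linear_obs n w (\<sigma>(i := x)) = (\<Sum>k<n. w k * \<sigma> k + (if k = i then w k * (x - \<sigma> k) else 0))"
    unfolding linear_obs_def by (intro sum.cong) (auto simp: algebra_simps)
  then show ?thesis using assms by (simp add: sum.distrib linear_obs_def)
qed

text \<open>The factor \<open>vertex_weight\<close> in the coefficients cancels the denominators of
  the mean spins, so the updates sum to an \<open>edge_form\<close> of \<open>h\<close> and the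
  configuration. Its symmetry lets the eigenvector equation of \<open>h\<close> be applied.\<close>

lemma heat_bath_linear_obs:
  assumes P: "perron_pair n J l h" and \<sigma>: "\<sigma> \<in> configs n" and n: "0 < n"
  shows "(\<Sum>i<n. heat_bath n J i (linear_obs n (\<lambda>k. vertex_weight n J k * h k)) \<sigma>) / n =
    (1 - (1 - l) / n) * linear_obs n (\<lambda>k. vertex_weight n J k * h k) \<sigma>"
proof -
  let ?f = "linear_obs n (\<lambda>k. vertex_weight n J k * h k)"
  have "heat_bath n J i ?f \<sigma> = ?f \<sigma> + h i * neighbour_sum n J \<sigma> i - vertex_weight n J i * h i * \<sigma> i"
    if i: "i < n" for i
  proof -
    have "(2 * plus_prob n J i \<sigma> - 1) * vertex_weight n J i = neighbour_sum n J \<sigma> i"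
      unfolding plus_prob_def local_field_def vertex_weight_def neighbour_sum_def
      by (intro mean_spin_linear configs_cases[OF \<sigma>] succ_mod_less pred_mod_less i)
    moreover have "heat_bath n J i ?f \<sigma> =
        ?f \<sigma> + h i * ((2 * plus_prob n J i \<sigma> - 1) * vertex_weight n J i) - vertex_weight n J i * h i * \<sigma> i"
      unfolding heat_bath_def linear_obs_upd[OF i] by (simp add: algebra_simps)
    ultimately show ?thesis by simp
  qed
  then have "(\<Sum>i<n. heat_bath n J i ?f \<sigma>) =
      n * ?f \<sigma> + edge_form n J h \<sigma> - ?f \<sigma>"
    by (simp add: sum.distrib sum_subtractf edge_form_eq_sum linear_obs_def)
  also have "edge_form n J h \<sigma> = edge_form n J \<sigma> h"
    by (simp add: edge_form_def algebra_simps)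
  also have "\<dots> = l * ?f \<sigma>"
    unfolding edge_form_eq_sum linear_obs_def sum_distrib_left
    using P by (intro sum.cong) (auto simp: perron_pair_def)
  finally show ?thesis using n by (simp add: field_simps)
qed

section \<open>No larger eigenvalue on non-constant functions\<close>

lemma constant_if_flip_invariant:
  assumes inv: "\<And>\<rho> j. \<rho> \<in> configs n \<Longrightarrow> j < n \<Longrightarrow> g (\<rho>(j := 1)) = g (\<rho>(j := - 1))"
    and \<sigma>: "\<sigma> \<in> configs n" and \<tau>: "\<tau> \<in> configs n"
  shows "g \<sigma> = g \<tau>"
proof -
  \<comment> \<open>Interpolation replacing the spins of \<open>\<sigma>\<close> by those of
    \<open>\<tau>\<close> one at a time.\<close>
  define \<rho> where "\<rho> k = (\<lambda>i. if i < k then \<tau> i else \<sigma> i)" for k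
  have "\<rho> k \<in> configs n \<and> g (\<rho> k) = g \<sigma>" if "k \<le> n" for k
    using that
  proof (induction k)
    case 0
    then show ?case using \<sigma> by (simp add: \<rho>_def)
  next
    case (Suc k)
    then have k: "k < n" and IH: "\<rho> k \<in> configs n" "g (\<rho> k) = g \<sigma>" by auto
    have step: "\<rho> (Suc k) = (\<rho> k)(k := \<tau> k)" by (auto simp: \<rho>_def)
    have eq: "g ((\<rho> k)(k := x)) = g ((\<rho> k)(k := y))"
      if "x = 1 \<or> x = - 1" "y = 1 \<or> y = - 1" for x y
      using that inv[OF IH(1) k] by auto
    have "g (\<rho> (Suc k)) = g ((\<rho> k)(k := \<rho> k k))"
      unfolding step by (intro eq configs_cases[OF IH(1) k] configs_cases[OF \<tau> k])
    then have "g (\<rho> (Suc k)) = g \<sigma>" using IH(2) by simp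
    moreover have "\<rho> (Suc k) \<in> configs n"
      unfolding step by (intro fun_upd_configs IH(1) k configs_cases[OF \<tau> k])
    ultimately show ?case by simp
  qed
  then have "g (\<rho> n) = g \<sigma>" by simp
  moreover have "\<rho> n = \<tau>"
    using \<sigma> \<tau> by (auto simp: \<rho>_def configs_def PiE_def extensional_def)
  ultimately show ?thesis by simp
qed

text \<open>One step scales the increments of \<open>f\<close> by \<open>e\<close> and those of
  \<open>g\<close> by \<open>r\<close> (the constant \<open>c\<close> drops out), while
  \<open>d f + g\<close> and \<open>d f - g\<close> stay increasing. For the least such
  \<open>d\<close> this gives \<open>r * d <= e * d\<close>, hence \<open>d = 0\<close>.\<close>

lemma heat_bath_top_eigenvalue:
  assumes n: "n \<ge> 3" and J: "\<And>i. i < n \<Longrightarrow> 0 < J i" and P: "perron_pair n J l h"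
    and r: "1 - (1 - l) / n < r"
    and eig: "\<And>\<sigma>. \<sigma> \<in> configs n \<Longrightarrow> (\<Sum>i<n. heat_bath n J i g \<sigma>) / n = r * g \<sigma> + c"
    and "\<sigma> \<in> configs n" "\<tau> \<in> configs n"
  shows "g \<sigma> = g \<tau>"
proof -
  define e where "e = 1 - (1 - l) / n"
  have "(1 - l) / n < 1"
    using n P by (simp add: perron_pair_def)
  then have e: "0 < e" "e < r" using r by (auto simp: e_def)
  define w where "w k = vertex_weight n J k * h k" for k
  have w: "0 < w k" if "k < n" for k
    using P that vertex_weight_pos[of n J k] by (simp add: w_def perron_pair_def)
  define f where "f = linear_obs n w"
  define D where "D \<sigma> j = g (\<sigma>(j := 1)) - g (\<sigma>(j := - 1))" for \<sigma> j
  have fD: "f (\<sigma>(j := 1)) - f (\<sigma>(j := - 1)) = 2 * w j" if "j < n" for \<sigma> j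
    unfolding f_def linear_obs_upd[OF that] by (simp add: algebra_simps)
  \<comment> \<open>The increment of \<open>f\<close> at \<open>j\<close> is \<open>2 * w j\<close>
    in every configuration, so the maximum of these ratios is the least \<open>d\<close> making both
    \<open>d f + g\<close> and \<open>d f - g\<close> increasing.\<close>
  define R where "R = (\<lambda>(\<sigma>, j). \<bar>D \<sigma> j\<bar> / (2 * w j)) ` (configs n \<times> {..<n})"
  define d where "d = Max R"
  have "finite R" by (simp add: R_def finite_configs)
  moreover have "R \<noteq> {}" using n \<open>\<sigma> \<in> configs n\<close> by (auto simp: R_def lessThan_empty_iff)
  ultimately have "d \<in> R" unfolding d_def by (rule Max_in)
  then obtain \<rho> k where dk: "\<rho> \<in> configs n" "k < n" "d = \<bar>D \<rho> k\<bar> / (2 * w k)"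
    by (auto simp: R_def)
  have D_le: "\<bar>D \<sigma> j\<bar> \<le> d * (2 * w j)" if "\<sigma> \<in> configs n" "j < n" for \<sigma> j
  proof -
    have "\<bar>D \<sigma> j\<bar> / (2 * w j) \<le> d"
      unfolding d_def using \<open>finite R\<close> by (rule Max_ge) (use that in \<open>auto simp: R_def\<close>)
    then show ?thesis using w[OF that(2)] by (simp add: pos_divide_le_eq)
  qed
  have D_le': "0 \<le> d * e * (2 * w j) + s * r * D \<sigma> j"
    if \<sigma>: "\<sigma> \<in> configs n" and j: "j < n" and s: "s = 1 \<or> s = - 1" for \<sigma> j s
  proof -
    let ?k = "\<lambda>\<sigma>. d * f \<sigma> + s * g \<sigma>"
    have "increasing n ?k"
      unfolding increasing_def
    proof (intro ballI allI impI)
      fix \<sigma> j assume a: "\<sigma> \<in> configs n" "j < n"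
      have "?k (\<sigma>(j := 1)) - ?k (\<sigma>(j := - 1)) = d * (2 * w j) + s * D \<sigma> j"
        unfolding fD[OF a(2), of \<sigma>, symmetric] D_def by (simp add: algebra_simps)
      moreover have "0 \<le> d * (2 * w j) + s * D \<sigma> j"
        using D_le[OF a] s by auto
      ultimately show "?k (\<sigma>(j := - 1)) \<le> ?k (\<sigma>(j := 1))" by simp
    qed
    from heat_bath_sum_increasing[OF n J this] \<sigma> j
    have le: "(\<Sum>i<n. heat_bath n J i ?k (\<sigma>(j := - 1))) / n \<le> (\<Sum>i<n. heat_bath n J i ?k (\<sigma>(j := 1))) / n"
      by (auto simp: increasing_def)
    have eq: "(\<Sum>i<n. heat_bath n J i ?k \<sigma>) / n = d * (e * f \<sigma>) + s * (r * g \<sigma> + c)"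
      if "\<sigma> \<in> configs n" for \<sigma>
    proof -
      have "(\<Sum>i<n. heat_bath n J i ?k \<sigma>) / n =
        d * ((\<Sum>i<n. heat_bath n J i f \<sigma>) / n) + s * ((\<Sum>i<n. heat_bath n J i g \<sigma>) / n)"
        unfolding heat_bath_def sum_distrib_left sum_divide_distrib sum.distrib[symmetric]
        using n by (intro sum.cong) (auto simp: field_simps)
      then show ?thesis
        using heat_bath_linear_obs[OF P that] eig[OF that] n
        by (simp add: f_def e_def w_def[abs_def])
    qed
    from le have "0 \<le> d * e * (f (\<sigma>(j := 1)) - f (\<sigma>(j := - 1))) + s * r * D \<sigma> j"
      using \<sigma> j by (simp add: eq fun_upd_configs D_def algebra_simps)
    then show ?thesis by (simp add: fD j)
  qed
  \<comment> \<open>Both signs are used at a pair attaining the maximum.\<close>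
  have "r * \<bar>D \<rho> k\<bar> \<le> d * e * (2 * w k)"
    using D_le'[OF dk(1,2), of 1] D_le'[OF dk(1,2), of "- 1"] e by (auto simp: abs_if)
  moreover have "\<bar>D \<rho> k\<bar> = d * (2 * w k)" using dk(3) w[OF dk(2)] by simp
  ultimately have "(r * d) * (2 * w k) \<le> (e * d) * (2 * w k)"
    by (simp only: mult.assoc mult.left_commute)
  then have "r * d \<le> e * d"
    by (rule mult_right_le_imp_le) (use w[OF dk(2)] in simp)
  moreover have "0 \<le> d" using dk(3) w[OF dk(2)] by simp
  ultimately have "d = 0"
    using e by (metis mult_le_cancel_right not_less order_antisym)
  show ?thesis
  proof (rule constant_if_flip_invariant[OF _ assms(6,7)])
    fix \<rho> j assume "\<rho> \<in> configs n" "j < n"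
    from D_le[OF this] show "g (\<rho>(j := 1)) = g (\<rho>(j := - 1))"
      by (simp add: \<open>d = 0\<close> D_def)
  qed
qed

section \<open>The second eigenvalue and the relaxation time\<close>

lemma glauber_mat_row:
  assumes "k < 2 ^ n"
  shows "(\<Sum>m<2 ^ n. glauber_mat n J $$ (k, m) * g (config_of n m)) =
    (\<Sum>\<tau>\<in>configs n. glauber n J (config_of n k) \<tau> * g \<tau>)"
proof -
  have "(\<Sum>m<2 ^ n. glauber_mat n J $$ (k, m) * g (config_of n m)) =
      (\<Sum>m<2 ^ n. glauber n J (config_of n k) (config_of n m) * g (config_of n m))"
    using assms by (intro sum.cong) (auto simp: glauber_mat_def)
  also have "\<dots> = (\<Sum>\<tau>\<in>configs n. glauber n J (config_of n k) \<tau> * g \<tau>)"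
    by (rule sum.reindex_bij_betw[OF bij_betw_config_of])
  finally show ?thesis .
qed

lemma mu_2_eq:
  assumes n: "n \<ge> 3" and J: "\<And>i. i < n \<Longrightarrow> 0 < J i" and P: "perron_pair n J l h"
  shows "mu n J 2 = 1 - (1 - l) / n"
proof -
  let ?A = "glauber_mat n J" and ?N = "2 ^ n :: nat" and ?mu = "1 - (1 - l) / n"
  define f where "f = linear_obs n (\<lambda>k. vertex_weight n J k * h k)"
  define v where "v = vec ?N (\<lambda>k. f (config_of n k))"
  have A: "?A \<in> carrier_mat ?N ?N" by (simp add: glauber_mat_def)
  have conf: "config_of n k \<in> configs n" if "k < ?N" for k
    using bij_betw_config_of[of n] that by (auto simp: bij_betw_def)
  have row: "(\<Sum>m<?N. ?A $$ (k, m) * g (config_of n m)) =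
      (\<Sum>i<n. heat_bath n J i g (config_of n k)) / n" if "k < ?N" for k g
    using that by (simp add: glauber_mat_row glauber_sum_eq_heat_bath[OF n conf])
  have "rev (sorted_list_of_multiset (proots (char_poly ?A))) ! 1 = ?mu"
  proof (rule second_eigenvalue_row_sums_one[OF A, of v])
    show "(\<Sum>j<?N. ?A $$ (i, j)) = 1" if "i < ?N" for i
      using row[OF that, of "\<lambda>_. 1"] n by (simp add: heat_bath_def)
    show "v \<noteq> 0\<^sub>v ?N"
    proof
      assume v0: "v = 0\<^sub>v ?N"
      \<comment> \<open>At the all-plus configuration \<open>f\<close> is the sum of its positive
        coefficients.\<close>
      let ?one = "\<lambda>i\<in>{..<n}. 1 :: real"
      have "?one \<in> configs n" by (auto simp: configs_def)
      then have "?one \<in> config_of n ` {..<?N}"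
        using bij_betw_config_of[of n] by (simp add: bij_betw_def)
      then obtain k where k: "k < ?N" "config_of n k = ?one"
        by (auto elim!: imageE)
      have "0 < f ?one"
        unfolding f_def linear_obs_def using n P vertex_weight_pos[of n J]
        by (intro sum_pos) (auto simp: perron_pair_def lessThan_empty_iff)
      moreover have "f ?one = v $ k" using k by (simp add: v_def)
      ultimately show False using v0 k by simp
    qed
    show "?A *\<^sub>v v = ?mu \<cdot>\<^sub>v v"
    proof (rule eq_vecI)
      fix k assume "k < dim_vec (?mu \<cdot>\<^sub>v v)"
      then have k: "k < ?N" by (simp add: v_def)
      have "(?A *\<^sub>v v) $ k = (\<Sum>m<?N. ?A $$ (k, m) * f (config_of n m))"
        using k A by (auto simp: v_def scalar_prod_def atLeast0LessThan intro!: sum.cong)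
      also have "\<dots> = ?mu * f (config_of n k)"
        unfolding row[OF k] f_def using heat_bath_linear_obs[OF P conf[OF k]] n by simp
      finally show "(?A *\<^sub>v v) $ k = (?mu \<cdot>\<^sub>v v) $ k"
        using k by (simp add: v_def)
    qed (use A in \<open>simp add: v_def\<close>)
    show "?mu < 1" using P n by (simp add: perron_pair_def)
    fix u r c i
    assume r: "?mu < r" and eig: "\<And>i. i < ?N \<Longrightarrow> (\<Sum>j<?N. ?A $$ (i, j) * u j) = r * u i + c"
      and i: "i < ?N"
    define g where "g \<tau> = u (inv_into {..<?N} (config_of n) \<tau>)" for \<tau>
    have gu: "g (config_of n k) = u k" if "k < ?N" for k
      using that bij_betw_config_of[of n] by (simp add: g_def bij_betw_def)
    have "g (config_of n i) = g (config_of n 0)"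
    proof (rule heat_bath_top_eigenvalue[OF n J P r, where g = g and c = c])
      fix \<sigma> assume "\<sigma> \<in> configs n"
      then obtain k where k: "k < ?N" "\<sigma> = config_of n k"
        using bij_betw_config_of[of n] by (auto simp: bij_betw_def)
      have "(\<Sum>m<?N. ?A $$ (k, m) * g (config_of n m)) = (\<Sum>m<?N. ?A $$ (k, m) * u m)"
        by (intro sum.cong) (auto simp: gu)
      then show "(\<Sum>i<n. heat_bath n J i g \<sigma>) / n = r * g \<sigma> + c"
        using row[OF k(1), of g] eig[OF k(1)] k by (simp add: gu)
    qed (use i conf in auto)
    then show "u i = u 0" using i by (simp add: gu)
  qed (simp_all add: v_def)
  then show ?thesis by (simp add: mu_def glauber_eigenvalues_def)
qed

theorem theorem1:
  fixes n :: nat and J J' :: "nat \<Rightarrow> real"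
  assumes "n \<ge> 3"
    and "\<And>i. i < n \<Longrightarrow> J i > 0"
    and "\<And>i. i < n \<Longrightarrow> J' i > 0"
    and "\<And>i. i < n \<Longrightarrow> J i \<le> J' i"
  shows "relaxation_time n J \<le> relaxation_time n J'"
proof -
  have n: "0 < n" using assms(1) by simp
  obtain l h where P: "perron_pair n J l h"
    by (rule perron_pair_exists[OF n, of J]) (use assms(2) in auto)
  obtain l' h' where P': "perron_pair n J' l' h'"
    by (rule perron_pair_exists[OF n, of J']) (use assms(3) in auto)
  have "l \<le> l'"
    by (rule perron_pair_mono[of n J J', OF _ _ P P' n]) (use assms in auto)
  moreover have "l' < 1" using P' by (simp add: perron_pair_def)
  \<comment> \<open>The factor \<open>n\<close> of the relaxation time cancels the denominator of
    the gap \<open>(1 - l) / n\<close>.\<close>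
  moreover have "relaxation_time n J = inverse (1 - l)" "relaxation_time n J' = inverse (1 - l')"
    using n mu_2_eq[OF assms(1,2) P] mu_2_eq[OF assms(1,3) P']
    by (simp_all add: relaxation_time_def)
  ultimately show ?thesis by (simp add: le_imp_inverse_le)
qed

end
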